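(* Let $m\ge 2$ be an integer and $p\in(0,1)$, and let $\{G_t\}$ be the sequence of random graphs generated by the Holme-Kim model with parameters $m$ and $p$. Then there exists a constant $c>0$ depending only on $m$ and $p$ such that the local clustering coefficients $\mathcal{C}^{loc}_{G_t}$ satisfy \[\lim_{t\to+\infty}\mathbb{P}\left(\mathcal{C}^{loc}_{G_t}\ge c\right)=1.\]
   Context: Graph notation. Graphs are finite and may have multiple edges (and, only at vertex $1$ in the model below, self-loops). $e_G(v,w)$ is the number of edges between $v$ and $w$ (each self-loop at $v$ contributes $2$ to $e_G(v,v)$); $v$ and $w$ are neighbors if $e_G(v,w)\ge 1$; $\Gamma_G(v)$ is the set of neighbors of $v$; $d_G(v)=\sum_{w\in\Gamma_G(v)}e_G(v,w)$ is the degree. For $G=G_t$ the subscript $G_t$ is abbreviated to $t$. Holme-Kim model. Parameters: an integer $m\ge2$ and $p\in[0,1]$. $G_1$ has vertex set $V_1=\{1\}$ and $m$ self-loops at vertex $1$ (so $d_1(1)=e_1(1,1)=2m$). For $t\ge1$, $G_{t+1}$ is obtained from $G_t$ (vertex set $V_t=\{1,\dots,t\}$) by adding a vertex $t+1$ and $m$ edges from $t+1$ to random vertices $Y^{(1)}_{t+1},\dots,Y^{(m)}_{t+1}\in V_t$ (repetitions allowed), chosen sequentially. Let $\mathcal{F}_t$ be the $\sigma$-field generated by all random choices up to time $t$, let $\mathcal{F}^{(i-1)}_t$ be the $\sigma$-field generated by $\mathcal{F}_t$ and all subsequent random choices made in choosing $Y^{(j)}_{t+1}$, $1\le j\le i-1$,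 and let $\xi^{(i)}_{t+1}$ be i.i.d. Bernoulli$(p)$ variables, with fresh coins independent of the past. Then $\mathbb{P}(Y^{(1)}_{t+1}=u\mid\mathcal{F}_t)=\frac{d_t(u)}{2mt}$ for $u\in V_t$, and for $2\le i\le m$: given $\mathcal{F}^{(i-1)}_t$ and $\xi^{(i)}_{t+1}=0$, $Y^{(i)}_{t+1}=u$ with probability $\frac{d_t(u)}{2mt}$ ($u\in V_t$); given $\mathcal{F}^{(i-1)}_t$ and $\xi^{(i)}_{t+1}=1$, $Y^{(i)}_{t+1}=u$ with probability $\frac{e_t(Y^{(i-1)}_{t+1},u)}{d_t(Y^{(i-1)}_{t+1})}$ if $u\in\Gamma_t(Y^{(i-1)}_{t+1})$ and $0$ otherwise. Clustering. A triangle in $G$ is a set of three distinct vertices that are pairwise neighbors; $\Delta_G(v)$ is the number of triangles containing $v$. If all degrees of $G$ are at least $2$, the local clustering coefficient at $v$ is $\mathcal{C}_G(v)=\Delta_G(v)/\binom{d_G(v)}{2}$, and $\mathcal{C}^{loc}_G=\frac{1}{|V_G|}\sum_{v\in V_G}\mathcal{C}_G(v)$. *)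

theory Defs
  imports "HOL-Probability.Probability" "HOL-Library.Uprod" "HOL-Library.Monad_Syntax"
begin

section \<open>Finite multigraphs\<close>

text \<open>A self-loop at \<open>v\<close> is the unordered pair \<open>Upair v v\<close>.\<close>

record 'a multigraph =
  verts :: "'a set"
  edges :: "'a uprod multiset"

definition edge_mult :: "'a multigraph \<Rightarrow> 'a \<Rightarrow> 'a \<Rightarrow> nat" where
  "edge_mult G v w = (if v = w then 2 else 1) * count (edges G) (Upair v w)"

definition neighbors :: "'a multigraph \<Rightarrow> 'a \<Rightarrow> 'a set" where
  "neighbors G v = {w \<in> verts G. edge_mult G v w \<ge> 1}"

definition vdegree :: "'a multigraph \<Rightarrow> 'a \<Rightarrow> nat" where
  "vdegree G v = (\<Sum>w\<in>neighbors G v. edge_mult G v w)"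

definition triangles :: "'a multigraph \<Rightarrow> 'a set set" where
  "triangles G = {T. T \<subseteq> verts G \<and> card T = 3 \<and>
     (\<forall>u\<in>T. \<forall>w\<in>T. u \<noteq> w \<longrightarrow> w \<in> neighbors G u)}"

definition triangles_at :: "'a multigraph \<Rightarrow> 'a \<Rightarrow> nat" where
  "triangles_at G v = card {T \<in> triangles G. v \<in> T}"

definition clustering_at :: "'a multigraph \<Rightarrow> 'a \<Rightarrow> real" where
  "clustering_at G v = real (triangles_at G v) / real (vdegree G v choose 2)"

definition local_clustering :: "'a multigraph \<Rightarrow> real" where
  "local_clustering G = (\<Sum>v\<in>verts G. clustering_at G v) / real (card (verts G))"


section \<open>The Holme--Kim model\<close>

definition initial_graph :: "nat \<Rightarrow> nat multigraph" where
  "initial_graph m = \<lparr>verts = {1}, edges = replicate_mset m (Upair 1 1)\<rparr>"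

text \<open>
  \<open>pref_choice m t G\<close> is only meaningful for graphs \<open>G\<close> that can occur as \<open>G\<^sub>t\<close>, and
  \<open>triad_choice G y\<close> only for vertices \<open>y\<close> of positive degree: elsewhere the weights need not
  sum to \<open>1\<close>. The lemmas \<open>pmf_pref_choice\<close>, \<open>pmf_triad_choice\<close> and \<open>holme_kim_support\<close>
  below show that all the instances used by the model have the stated probabilities.
\<close>

definition pref_choice :: "nat \<Rightarrow> nat \<Rightarrow> nat multigraph \<Rightarrow> nat pmf" where
  "pref_choice m t G = embed_pmf (\<lambda>u.
     if u \<in> verts G then real (vdegree G u) / (2 * real m * real t) else 0)"

definition triad_choice :: "nat multigraph \<Rightarrow> nat \<Rightarrow> nat pmf" where
  "triad_choice G y = embed_pmf (\<lambda>u.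
     if u \<in> neighbors G y then real (edge_mult G y u) / real (vdegree G y) else 0)"

text \<open>The argument \<open>y\<close> is the target of the previous edge, and the coin shows \<open>True\<close> with
  probability \<open>p\<close>.\<close>

definition next_choice :: "nat \<Rightarrow> real \<Rightarrow> nat \<Rightarrow> nat multigraph \<Rightarrow> nat \<Rightarrow> nat pmf" where
  "next_choice m p t G y = do {
     \<xi> \<leftarrow> bernoulli_pmf p;
     if \<xi> then triad_choice G y else pref_choice m t G
   }"

text \<open>Joint law of the first \<open>i\<close> targets of the new vertex \<open>t + 1\<close>, given \<open>G\<^sub>t = G\<close>; they are
  listed in the order in which they are chosen.\<close>

primrec choices :: "nat \<Rightarrow> real \<Rightarrow> nat \<Rightarrow> nat multigraph \<Rightarrow> nat \<Rightarrow> nat list pmf" where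
  "choices m p t G 0 = return_pmf []"
| "choices m p t G (Suc i) = do {
     ys \<leftarrow> choices m p t G i;
     y \<leftarrow> (if ys = [] then pref_choice m t G else next_choice m p t G (last ys));
     return_pmf (ys @ [y])
   }"

definition add_vertex :: "nat multigraph \<Rightarrow> nat \<Rightarrow> nat list \<Rightarrow> nat multigraph" where
  "add_vertex G v ys =
     \<lparr>verts = insert v (verts G), edges = edges G + mset (map (Upair v) ys)\<rparr>"

text \<open>\<open>holme_kim m p t\<close> is the law of \<open>G\<^sub>t\<close>. The choices made at step \<open>t + 1\<close> depend on the past
  only through \<open>G\<^sub>t\<close>, so these laws are obtained by iterating a Markov kernel. Time starts at
  \<open>1\<close>; the value at \<open>0\<close> is a dummy.\<close>

fun holme_kim :: "nat \<Rightarrow> real \<Rightarrow> nat \<Rightarrow> nat multigraph pmf" where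
  "holme_kim m p 0 = return_pmf (initial_graph m)"
| "holme_kim m p (Suc 0) = return_pmf (initial_graph m)"
| "holme_kim m p (Suc (Suc t)) = do {
     G \<leftarrow> holme_kim m p (Suc t);
     ys \<leftarrow> choices m p (Suc t) G m;
     return_pmf (add_vertex G (Suc (Suc t)) ys)
   }"


section \<open>The sampling weights are probabilities\<close>

lemma edge_mult_sum:
  fixes V :: "'a set"
  assumes "finite V" "\<And>e. e \<in># M \<Longrightarrow> set_uprod e \<subseteq> V"
  shows "(\<Sum>v\<in>V. \<Sum>w\<in>V. (if v = w then 2 else 1) * count M (Upair v w)) = 2 * size M"
  using assms(2)
proof (induction M)
  case empty
  then show ?case by simp
next
  case (add e M)
  obtain a b where e: "e = Upair a b" by (cases e) auto
  have ab: "a \<in> V" "b \<in> V" using add.prems[of e] e by auto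
  have row: "(\<Sum>w\<in>V. (if v = w then 2 else 1) * (if e = Upair v w then 1 else (0::nat)))
      = (if v = a then 1 else 0) + (if v = b then 1 else 0)" if "v \<in> V" for v
  proof -
    have "(\<Sum>w\<in>V. (if v = w then 2 else 1) * (if e = Upair v w then 1 else (0::nat)))
        = (\<Sum>w\<in>V. (if w = b then if v = a then 1 else 0 else 0) +
                    (if w = a then if v = b then 1 else 0 else 0))"
      by (intro sum.cong) (auto simp: e)
    also have "\<dots> = (if v = a then 1 else 0) + (if v = b then 1 else 0)"
      using ab assms(1) by (simp add: sum.distrib)
    finally show ?thesis .
  qed
  have "(\<Sum>v\<in>V. \<Sum>w\<in>V. (if v = w then 2 else 1) * count (add_mset e M) (Upair v w))
      = (\<Sum>v\<in>V. (\<Sum>w\<in>V. (if v = w then 2 else 1) * count M (Upair v w)) +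
          (\<Sum>w\<in>V. (if v = w then 2 else 1) * (if e = Upair v w then 1 else 0)))"
    by (auto simp: sum.distrib[symmetric] algebra_simps intro!: sum.cong)
  also have "\<dots> = 2 * size M + (\<Sum>v\<in>V. (if v = a then 1 else 0) + (if v = b then 1 else 0))"
    using add row by (simp add: sum.distrib)
  also have "\<dots> = 2 * size (add_mset e M)"
    using ab assms(1) by (simp add: sum.distrib)
  finally show ?case .
qed

lemma vdegree_altdef:
  assumes "finite (verts G)"
  shows "vdegree G v = (\<Sum>w\<in>verts G. edge_mult G v w)"
  unfolding vdegree_def neighbors_def using assms by (intro sum.mono_neutral_left) auto

lemma handshake:
  assumes "finite (verts G)" "\<And>e. e \<in># edges G \<Longrightarrow> set_uprod e \<subseteq> verts G"
  shows "(\<Sum>v\<in>verts G. vdegree G v) = 2 * size (edges G)"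
  using edge_mult_sum[OF assms] by (simp add: vdegree_altdef assms(1) edge_mult_def)

lemma pmf_embed_pmf_finite:
  assumes "finite A" "\<And>x. x \<in> A \<Longrightarrow> 0 \<le> f x" "(\<Sum>x\<in>A. f x) = 1"
  shows "pmf (embed_pmf (\<lambda>x. if x \<in> A then f x else 0)) u = (if u \<in> A then f u else (0::real))"
proof (rule pmf_embed_pmf)
  have "(\<integral>\<^sup>+x. ennreal (if x \<in> A then f x else 0) \<partial>count_space UNIV) = (\<Sum>x\<in>A. ennreal (f x))"
    using assms(1) by (subst nn_integral_count_space'[of A]) auto
  also have "\<dots> = 1"
    using assms by (simp add: sum_ennreal)
  finally show "(\<integral>\<^sup>+x. ennreal (if x \<in> A then f x else 0) \<partial>count_space UNIV) = 1" .
qed (use assms in auto)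

lemma pmf_triad_choice:
  assumes "finite (verts G)" "vdegree G y > 0"
  shows "pmf (triad_choice G y) u =
    (if u \<in> neighbors G y then real (edge_mult G y u) / real (vdegree G y) else 0)"
  unfolding triad_choice_def
proof (rule pmf_embed_pmf_finite)
  have "(\<Sum>x\<in>neighbors G y. real (edge_mult G y x) / real (vdegree G y))
      = real (vdegree G y) / real (vdegree G y)"
    unfolding sum_divide_distrib[symmetric] by (simp add: vdegree_def)
  then show "(\<Sum>x\<in>neighbors G y. real (edge_mult G y x) / real (vdegree G y)) = 1"
    using assms by simp
qed (use assms in \<open>auto simp: neighbors_def\<close>)

lemma pmf_pref_choice_aux:
  assumes "finite (verts G)" "\<And>e. e \<in># edges G \<Longrightarrow> set_uprod e \<subseteq> verts G"
    and "size (edges G) = m * t" "m > 0" "t > 0"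
  shows "pmf (pref_choice m t G) u =
    (if u \<in> verts G then real (vdegree G u) / (2 * real m * real t) else 0)"
  unfolding pref_choice_def
proof (rule pmf_embed_pmf_finite)
  have "(\<Sum>x\<in>verts G. real (vdegree G x)) = 2 * real m * real t"
    using handshake[OF assms(1,2)] assms(3) by (metis of_nat_mult of_nat_numeral of_nat_sum mult.assoc)
  then show "(\<Sum>x\<in>verts G. real (vdegree G x) / (2 * real m * real t)) = 1"
    unfolding sum_divide_distrib[symmetric] using assms by simp
qed (use assms in auto)

lemma choices_support:
  assumes "finite (verts G)" "\<And>e. e \<in># edges G \<Longrightarrow> set_uprod e \<subseteq> verts G"
    and "size (edges G) = m * t" "m > 0" "t > 0"
    and "\<And>v. v \<in> verts G \<Longrightarrow> vdegree G v > 0"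
    and "ys \<in> set_pmf (choices m p t G i)"
  shows "length ys = i \<and> set ys \<subseteq> verts G"
  using assms(7)
proof (induction i arbitrary: ys)
  case 0
  then show ?case by simp
next
  case (Suc i)
  from Suc.prems obtain zs y where zs: "zs \<in> set_pmf (choices m p t G i)" "ys = zs @ [y]"
    and y: "y \<in> set_pmf (if zs = [] then pref_choice m t G else next_choice m p t G (last zs))"
    by auto
  note IH = Suc.IH[OF zs(1)]
  have pref: "set_pmf (pref_choice m t G) \<subseteq> verts G"
    using pmf_pref_choice_aux[OF assms(1-5)] by (auto simp: set_pmf_iff split: if_splits)
  have triad: "set_pmf (triad_choice G (last zs)) \<subseteq> verts G" if "zs \<noteq> []"
  proof -
    have "last zs \<in> verts G" using that IH last_in_set by blast
    then show ?thesis
      using pmf_triad_choice[OF assms(1) assms(6)]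
      by (auto simp: set_pmf_iff neighbors_def split: if_splits)
  qed
  have "y \<in> verts G"
    using y pref triad by (auto simp: next_choice_def split: if_splits)
  with IH zs show ?case by auto
qed

lemma holme_kim_support:
  assumes "m > 0" "t > 0" "G \<in> set_pmf (holme_kim m p t)"
  shows "verts G = {1..t}" "\<And>e. e \<in># edges G \<Longrightarrow> set_uprod e \<subseteq> {1..t}"
    "size (edges G) = m * t" "\<And>v. v \<in> {1..t} \<Longrightarrow> vdegree G v \<ge> m"
proof -
  have "verts G = {1..t} \<and> (\<forall>e\<in>#edges G. set_uprod e \<subseteq> {1..t}) \<and>
    size (edges G) = m * t \<and> (\<forall>v\<in>{1..t}. vdegree G v \<ge> m)"
    using assms
  proof (induction m p t arbitrary: G rule: holme_kim.induct)
    case (2 m p)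
    then show ?case
      by (auto simp: initial_graph_def vdegree_altdef edge_mult_def)
  next
    case (3 m p t)
    from 3(4) obtain H ys where H: "H \<in> set_pmf (holme_kim m p (Suc t))"
      and ys: "ys \<in> set_pmf (choices m p (Suc t) H m)"
      and G: "G = add_vertex H (Suc (Suc t)) ys" by auto
    note IH = 3(1)[OF 3(2) _ H]
    have fin: "finite (verts H)" using IH by simp
    have L: "length ys = m \<and> set ys \<subseteq> verts H"
      using IH 3(2) by (intro choices_support[OF fin _ _ _ _ _ ys]) force+
    have vG: "verts G = {1..Suc (Suc t)}" using IH G by (auto simp: add_vertex_def)
    have fG: "finite (verts G)" using vG by simp
    have eG: "edges G = edges H + mset (map (Upair (Suc (Suc t))) ys)"
      using G by (simp add: add_vertex_def)
    have wG: "\<forall>e\<in>#edges G. set_uprod e \<subseteq> {1..Suc (Suc t)}"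
    proof
      fix e assume "e \<in># edges G"
      then consider "e \<in># edges H" | y where "y \<in> set ys" "e = Upair (Suc (Suc t)) y"
        unfolding eG by auto
      then show "set_uprod e \<subseteq> {1..Suc (Suc t)}"
      proof cases
        case 1
        then have "set_uprod e \<subseteq> {1..Suc t}" using IH by simp
        then show ?thesis by force
      next
        case 2
        then have "y \<in> {1..Suc t}" using L IH by auto
        with 2 show ?thesis by auto
      qed
    qed
    have new: "m \<le> vdegree G (Suc (Suc t))"
    proof -
      have "count (mset (map (Upair (Suc (Suc t))) ys)) (Upair (Suc (Suc t)) w) = count (mset ys) w" for w
        by (induction ys) auto
      then have "(\<Sum>w\<in>verts G. count (mset ys) w) \<le> vdegree G (Suc (Suc t))"
        unfolding vdegree_altdef[OF fG] edge_mult_def eG by (intro sum_mono) auto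
      moreover have "(\<Sum>w\<in>verts G. count (mset ys) w) = (\<Sum>w\<in>set ys. count (mset ys) w)"
        using L IH vG by (intro sum.mono_neutral_right) auto
      moreover have "\<dots> = m" using L size_multiset_overloaded_eq[of "mset ys"] by simp
      ultimately show ?thesis by simp
    qed
    have old: "m \<le> vdegree G v" if "v \<in> {1..Suc t}" for v
    proof -
      have "vdegree H v \<le> (\<Sum>w\<in>verts H. edge_mult G v w)"
        unfolding vdegree_altdef[OF fin] edge_mult_def eG by (intro sum_mono) auto
      also have "\<dots> \<le> vdegree G v"
        unfolding vdegree_altdef[OF fG] using fG vG IH by (intro sum_mono2) auto
      finally show ?thesis using IH that by force
    qed
    have "m \<le> vdegree G v" if "v \<in> {1..Suc (Suc t)}" for v
      using new old[of v] that by (cases "v = Suc (Suc t)") auto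
    then show ?case using vG wG IH eG L by auto
  qed simp
  then show "verts G = {1..t}" "\<And>e. e \<in># edges G \<Longrightarrow> set_uprod e \<subseteq> {1..t}"
    "size (edges G) = m * t" "\<And>v. v \<in> {1..t} \<Longrightarrow> vdegree G v \<ge> m" by auto
qed

lemma pmf_pref_choice:
  assumes "m > 0" "t > 0" "G \<in> set_pmf (holme_kim m p t)"
  shows "pmf (pref_choice m t G) u =
    (if u \<in> {1..t} then real (vdegree G u) / (2 * real m * real t) else 0)"
proof -
  note S = holme_kim_support[OF assms]
  show ?thesis
    using pmf_pref_choice_aux[of G m t u] S assms by auto
qed

end

theory Submission
  imports Defs
begin

text \<open>
  A vertex that lies in a triangle and has degree at most \<open>D\<close> has local clustering coefficient at
  least \<open>1 / (D choose 2)\<close>. Since the degrees of \<open>G\<^sub>t\<close> sum to \<open>2 m t\<close>, only a small proportion of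
  the vertices can have a degree above a large constant \<open>D\<close>. So it is enough that, with
  probability tending to \<open>1\<close>, a positive proportion of the vertices lies in a triangle; for such
  graphs \<open>local_clustering_ge\<close> gives the bound deterministically.

  From time \<open>t = 2\<close> on, and whatever \<open>G\<^sub>t\<close> is, the new vertex lies in a triangle with probability at least
  \<open>p / 4\<close> (\<open>prob_adjacent_targets\<close>). It is enough that its first target \<open>u\<close> is not
  vertex \<open>1\<close> and that its second edge is a triad formation step: as \<open>u\<close> has no self-loop, the second
  target is then a neighbor of \<open>u\<close> other than \<open>u\<close>, and the three vertices span a triangle. Every
  vertex has degree at least \<open>m\<close>, hence the vertices other than \<open>1\<close> carry at least \<open>m (t - 1)\<close> of
  the total degree \<open>2 m t\<close>, so that the first target avoids vertex \<open>1\<close> with probability at least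
  \<open>1 / 4\<close>. This holds conditionally on every possible past, and triangles never
  disappear. The number \<open>N\<^sub>t\<close> of vertices in triangles thus grows at least as fast as a
  binomial variable. In terms of a moment generating function, the expectation of \<open>(1 / 2) ^ N\<^sub>t\<close>
  shrinks by a factor \<open>1 - p / 8\<close> in each step (\<open>exp_moment\<close>), and Markov's inequality makes
  \<open>N\<^sub>t < \<delta> t\<close> exponentially unlikely for small \<open>\<delta>\<close> (\<open>prob_few_triangles\<close>).
\<close>

section \<open>Triangles and local clustering\<close>

lemma mem_neighbors_iff:
  "w \<in> neighbors G v \<longleftrightarrow> w \<in> verts G \<and> Upair v w \<in># edges G"
  by (auto simp: neighbors_def edge_mult_def Suc_le_eq)

lemma Union_triangles_subset: "\<Union>(triangles G) \<subseteq> verts G"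
  by (auto simp: triangles_def)

lemma triangles_add_vertex: "triangles G \<subseteq> triangles (add_vertex G v ys)"
  by (auto simp: triangles_def mem_neighbors_iff add_vertex_def)

lemma triangles_at_pos:
  assumes "finite (verts G)" "v \<in> \<Union>(triangles G)"
  shows "triangles_at G v \<ge> 1"
proof -
  have "triangles G \<subseteq> Pow (verts G)" by (auto simp: triangles_def)
  then have "finite (triangles G)" using assms(1) by (meson finite_Pow_iff finite_subset)
  then have "finite {T \<in> triangles G. v \<in> T}" by simp
  moreover have "{T \<in> triangles G. v \<in> T} \<noteq> {}" using assms(2) by auto
  ultimately show ?thesis
    unfolding triangles_at_def by (metis One_nat_def Suc_leI card_gt_0_iff)
qed

text \<open>The condition is on the graph before the new vertex is added. It is monotone in the list of
  targets, so it may be checked on the first two of them.\<close>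

definition adjacent_targets :: "'a multigraph \<Rightarrow> 'a list \<Rightarrow> bool" where
  "adjacent_targets G ys \<longleftrightarrow> (\<exists>u\<in>set ys. \<exists>w\<in>set ys. u \<noteq> w \<and> w \<in> neighbors G u)"

lemma new_vertex_in_triangle:
  fixes G :: "nat multigraph"
  assumes "adjacent_targets G ys" "set ys \<subseteq> verts G" "v \<notin> verts G"
  shows "v \<in> \<Union>(triangles (add_vertex G v ys))"
proof -
  obtain u w where uw: "u \<in> set ys" "w \<in> set ys" "u \<noteq> w" "w \<in> neighbors G u"
    using assms(1) by (auto simp: adjacent_targets_def)
  have "u \<noteq> v" "w \<noteq> v" using uw assms by auto
  moreover have "Upair w u \<in># edges G"
    using uw(4) by (subst Upair_inject[THEN iffD2, of w u u w]) (auto simp: mem_neighbors_iff)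
  ultimately have "{v, u, w} \<in> triangles (add_vertex G v ys)"
    using uw assms
    by (auto simp: triangles_def mem_neighbors_iff add_vertex_def Upair_inject
        intro: image_eqI[of _ "Upair v"])
  then show ?thesis by blast
qed

lemma card_Union_triangles_add_vertex:
  fixes G :: "nat multigraph"
  assumes "finite (verts G)" "set ys \<subseteq> verts G" "v \<notin> verts G"
  shows "card (\<Union>(triangles G)) + of_bool (adjacent_targets G ys)
       \<le> card (\<Union>(triangles (add_vertex G v ys)))"
proof -
  let ?A = "\<Union>(triangles G)" and ?B = "\<Union>(triangles (add_vertex G v ys))"
  have fin: "finite ?B"
    using Union_triangles_subset[of "add_vertex G v ys"] assms(1)
    by (auto simp: add_vertex_def intro: finite_subset)
  have sub: "?A \<subseteq> ?B" using triangles_add_vertex by blast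
  show ?thesis
  proof (cases "adjacent_targets G ys")
    case True
    have "insert v ?A \<subseteq> ?B" using sub new_vertex_in_triangle[OF True assms(2,3)] by simp
    moreover have "v \<notin> ?A" using Union_triangles_subset[of G] assms(3) by blast
    ultimately show ?thesis
      using card_mono[OF fin, of "insert v ?A"] finite_subset[OF sub fin] True by simp
  next
    case False
    then show ?thesis using card_mono[OF fin sub] by simp
  qed
qed

text \<open>In the application \<open>k\<close> is \<open>2 m\<close>, so that \<open>k\<close> bounds the average degree. At most a proportion
  \<open>k / D \<le> \<delta> / 2\<close> of the vertices can have degree above \<open>D\<close>, which leaves a proportion \<open>\<delta> / 2\<close> of
  vertices that lie in a triangle and have degree at most \<open>D\<close>.\<close>

lemma local_clustering_ge:
  fixes \<delta> :: real
  assumes fin: "finite (verts G)" and ne: "verts G \<noteq> {}"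
    and deg: "\<And>v. v \<in> verts G \<Longrightarrow> vdegree G v \<ge> 2"
    and sum: "(\<Sum>v\<in>verts G. vdegree G v) \<le> k * card (verts G)"
    and tri: "real (card (\<Union>(triangles G))) \<ge> \<delta> * real (card (verts G))"
    and \<delta>: "\<delta> > 0" and D: "real D * \<delta> \<ge> 2 * real k" "D \<ge> 2"
  shows "local_clustering G \<ge> \<delta> / (2 * real (D choose 2))"
proof -
  define n where "n = card (verts G)"
  have n: "n > 0" using fin ne by (simp add: n_def card_gt_0_iff)
  define high where "high = {v \<in> verts G. vdegree G v > D}"
  define good where "good = \<Union>(triangles G) - high"
  have good_sub: "good \<subseteq> verts G" using Union_triangles_subset[of G] by (auto simp: good_def)
  have fin': "finite high" "finite good" "finite (\<Union>(triangles G))"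
    using fin good_sub Union_triangles_subset[of G] by (auto simp: high_def intro: finite_subset)
  have "card high * D \<le> (\<Sum>v\<in>high. vdegree G v)"
    using sum_bounded_below[of high D "vdegree G"] by (auto simp: high_def less_imp_le)
  also have "\<dots> \<le> (\<Sum>v\<in>verts G. vdegree G v)"
    using fin by (intro sum_mono2) (auto simp: high_def)
  finally have "card high * D \<le> k * n" using sum by (simp add: n_def)
  then have "real (card high) * real D \<le> real k * real n"
    by (metis of_nat_le_iff of_nat_mult)
  also have "\<dots> \<le> (\<delta> * real n / 2) * real D"
    using mult_right_mono[OF D(1), of "real n / 2"] by (simp add: algebra_simps)
  finally have "real (card high) \<le> \<delta> * real n / 2" using D(2) by simp
  moreover have "real (card (\<Union>(triangles G))) - real (card high) \<le> real (card good)"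
  proof -
    have "card (\<Union>(triangles G)) - card high \<le> card good"
      unfolding good_def using fin' by (intro diff_card_le_card_Diff) auto
    then show ?thesis by linarith
  qed
  ultimately have good: "\<delta> * real n / 2 \<le> real (card good)" using tri by (simp add: n_def)
  have "1 / real (D choose 2) \<le> clustering_at G v" if v: "v \<in> good" for v
  proof -
    have v': "v \<in> verts G" "vdegree G v \<le> D" "v \<in> \<Union>(triangles G)"
      using v good_sub by (auto simp: good_def high_def)
    have "vdegree G v choose 2 \<le> D choose 2" using v'(2) by (rule binomial_right_mono)
    moreover have "vdegree G v choose 2 > 0" using deg[OF v'(1)] by simp
    ultimately show ?thesis
      unfolding clustering_at_def using triangles_at_pos[OF fin v'(3)]
      by (intro frac_le) auto
  qed
  then have "real (card good) * (1 / real (D choose 2)) \<le> (\<Sum>v\<in>good. clustering_at G v)"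
    by (rule sum_bounded_below)
  also have "\<dots> \<le> (\<Sum>v\<in>verts G. clustering_at G v)"
    using fin good_sub by (intro sum_mono2) (auto simp: clustering_at_def)
  finally have S: "real (card good) * (1 / real (D choose 2)) \<le> (\<Sum>v\<in>verts G. clustering_at G v)" .
  have "\<delta> / (2 * real (D choose 2)) * real n = \<delta> * real n / 2 * (1 / real (D choose 2))" by simp
  also have "\<dots> \<le> real (card good) * (1 / real (D choose 2))"
    using good by (intro mult_right_mono) auto
  also note S
  finally show ?thesis
    using n by (simp add: local_clustering_def n_def[symmetric] pos_le_divide_eq)
qed

section \<open>The graphs of the Holme--Kim process\<close>

lemma choices_holme_kim_support:
  assumes "m > 0" "t > 0" "H \<in> set_pmf (holme_kim m p t)" "ys \<in> set_pmf (choices m p t H i)"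
  shows "length ys = i" "set ys \<subseteq> {1..t}"
proof -
  note S = holme_kim_support[OF assms(1-3)]
  have "length ys = i \<and> set ys \<subseteq> verts H"
    using S assms by (intro choices_support[OF _ _ _ _ _ _ assms(4)]) force+
  then show "length ys = i" "set ys \<subseteq> {1..t}" using S by auto
qed

lemma holme_kim_loop:
  assumes "m > 0" "t > 0" "G \<in> set_pmf (holme_kim m p t)" "Upair v v \<in># edges G"
  shows "v = 1"
  using assms
proof (induction m p t arbitrary: G rule: holme_kim.induct)
  case (2 m p)
  then show ?case by (auto simp: initial_graph_def split: if_splits)
next
  case (3 m p t)
  from 3(4) obtain H ys where H: "H \<in> set_pmf (holme_kim m p (Suc t))"
    and ys: "ys \<in> set_pmf (choices m p (Suc t) H m)"
    and G: "G = add_vertex H (Suc (Suc t)) ys" by auto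
  have "Suc (Suc t) \<notin> set ys" using choices_holme_kim_support(2)[OF 3(2) _ H ys] by auto
  then show ?case using 3(5) 3(1)[OF 3(2) _ H] G by (auto simp: add_vertex_def)
qed simp

section \<open>The probability of closing a triangle\<close>

text \<open>The chain rule \<open>P(A) P(B | A) \<le> P(B)\<close> for a two-stage experiment, with \<open>P(B | A)\<close>
  replaced by a bound \<open>c\<close> that holds for every outcome in \<open>A\<close>.\<close>

lemma prob_bind_pmf_ge:
  assumes "\<And>x. x \<in> A \<Longrightarrow> c \<le> measure_pmf.prob (N x) B" "0 \<le> c"
  shows "measure_pmf.prob M A * c \<le> measure_pmf.prob (bind_pmf M N) B"
proof -
  have "ennreal (measure_pmf.prob M A * c) = (\<integral>\<^sup>+x. ennreal c * indicator A x \<partial>M)"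
    using assms(2)
    by (simp add: nn_integral_cmult_indicator measure_pmf.emeasure_eq_measure
        ennreal_mult[symmetric] mult.commute)
  also have "\<dots> \<le> (\<integral>\<^sup>+x. emeasure (N x) B \<partial>M)"
    using assms(1)
    by (intro nn_integral_mono)
      (auto simp: indicator_def measure_pmf.emeasure_eq_measure)
  also have "\<dots> = ennreal (measure_pmf.prob (bind_pmf M N) B)"
    by (simp add: measure_pmf.emeasure_eq_measure[symmetric])
  finally show ?thesis by simp
qed

lemma prob_choices_Suc_ge:
  assumes "\<And>ys y. P ys \<Longrightarrow> P (ys @ [y])"
  shows "measure_pmf.prob (choices m p t G i) {ys. P ys}
       \<le> measure_pmf.prob (choices m p t G (Suc i)) {ys. P ys}"
proof -
  have "measure_pmf.prob (choices m p t G i) {ys. P ys} * 1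
     \<le> measure_pmf.prob (choices m p t G (Suc i)) {ys. P ys}"
    unfolding choices.simps
  proof (rule prob_bind_pmf_ge)
    fix ys assume "ys \<in> {ys. P ys}"
    then have "P (ys @ [y])" for y using assms by simp
    then have "measure_pmf.prob ((if ys = [] then pref_choice m t G
        else next_choice m p t G (last ys)) \<bind> (\<lambda>y. return_pmf (ys @ [y]))) {ys. P ys} = 1"
      by (subst measure_pmf.prob_eq_1) (auto simp: AE_measure_pmf_iff)
    then show "1 \<le> measure_pmf.prob ((if ys = [] then pref_choice m t G
        else next_choice m p t G (last ys)) \<bind> (\<lambda>y. return_pmf (ys @ [y]))) {ys. P ys}"
      by simp
  qed simp
  then show ?thesis by simp
qed

text \<open>Every vertex other than \<open>1\<close> contributes at least \<open>m\<close> to the total degree \<open>2 m t\<close>, so the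
  probability is at least \<open>(t - 1) / (2 t)\<close>. At \<open>t = 1\<close> it is \<open>0\<close>.\<close>

lemma prob_pref_choice_not_root:
  assumes "m > 0" "t \<ge> 2" "G \<in> set_pmf (holme_kim m p t)"
  shows "measure_pmf.prob (pref_choice m t G) {2..t} \<ge> 1 / 4"
proof -
  have t: "t > 0" using assms by simp
  have "(1::real) / 4 \<le> real (t - 1) / (2 * real t)"
    using assms(2) by (simp add: field_simps)
  also have "\<dots> = (\<Sum>u\<in>{2..t}. real m / (2 * real m * real t))"
    using assms(1) by simp
  also have "\<dots> \<le> (\<Sum>u\<in>{2..t}. pmf (pref_choice m t G) u)"
  proof (rule sum_mono)
    fix u assume u: "u \<in> {2..t}"
    then have "m \<le> vdegree G u"
      by (intro holme_kim_support(4)[OF assms(1) t assms(3)]) auto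
    then have "real m / (2 * real m * real t) \<le> real (vdegree G u) / (2 * real m * real t)"
      by (intro divide_right_mono) auto
    then show "real m / (2 * real m * real t) \<le> pmf (pref_choice m t G) u"
      using u unfolding pmf_pref_choice[OF assms(1) t assms(3)] by simp
  qed
  also have "\<dots> = measure_pmf.prob (pref_choice m t G) {2..t}"
    by (simp add: measure_measure_pmf_finite)
  finally show ?thesis .
qed

lemma prob_next_choice_neighbors:
  assumes "finite (verts G)" "vdegree G y > 0" "0 \<le> p" "p \<le> 1"
  shows "measure_pmf.prob (next_choice m p t G y) (neighbors G y) \<ge> p"
proof -
  have "finite (neighbors G y)" using assms(1) by (simp add: neighbors_def)
  then have "measure_pmf.prob (triad_choice G y) (neighbors G y)
      = (\<Sum>u\<in>neighbors G y. real (edge_mult G y u)) / real (vdegree G y)"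
    by (simp add: measure_measure_pmf_finite pmf_triad_choice[OF assms(1,2)] sum_divide_distrib)
  also have "\<dots> = 1" using assms(2) by (simp add: vdegree_def flip: of_nat_sum)
  finally have 1: "measure_pmf.prob (triad_choice G y) (neighbors G y) = 1" .
  have "measure_pmf.prob (bernoulli_pmf p) {True} * 1
      \<le> measure_pmf.prob (next_choice m p t G y) (neighbors G y)"
    unfolding next_choice_def by (rule prob_bind_pmf_ge) (auto simp: 1)
  then show ?thesis using assms by (simp add: measure_pmf_single)
qed

text \<open>The first target \<open>u\<close> avoids vertex \<open>1\<close> with probability at least \<open>1 / 4\<close>, and then the second
  one is a neighbor of \<open>u\<close> with probability at least \<open>p\<close>. The neighbor differs from \<open>u\<close> because only
  vertex \<open>1\<close> carries self-loops.\<close>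

lemma prob_adjacent_targets:
  assumes "m \<ge> 2" "t \<ge> 2" "0 \<le> p" "p \<le> 1" "G \<in> set_pmf (holme_kim m p t)"
  shows "measure_pmf.prob (choices m p t G m) {ys. adjacent_targets G ys} \<ge> p / 4"
proof -
  have m: "m > 0" and t: "t > 0" using assms by auto
  note S = holme_kim_support[OF m t assms(5)]
  let ?A = "{ys. adjacent_targets G ys}"
  let ?first = "(\<lambda>u. [u]) ` {2..t}"
  have "measure_pmf.prob (pref_choice m t G) {2..t} * 1
      \<le> measure_pmf.prob (choices m p t G 1) ?first"
  proof -
    have "choices m p t G 1 = pref_choice m t G \<bind> (\<lambda>u. return_pmf [u])"
      by (simp add: bind_return_pmf)
    then show ?thesis by (simp only:) (rule prob_bind_pmf_ge, auto)
  qed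
  then have first: "1 / 4 \<le> measure_pmf.prob (choices m p t G 1) ?first"
    using prob_pref_choice_not_root[OF m assms(2,5)] by simp
  have "measure_pmf.prob (choices m p t G 1) ?first * p
      \<le> measure_pmf.prob (choices m p t G (Suc 1)) ?A"
    unfolding choices.simps(2)[of m p t G 1]
  proof (rule prob_bind_pmf_ge)
    fix ys assume "ys \<in> ?first"
    then obtain u where u: "ys = [u]" "u \<in> {2..t}" by auto
    have "Upair u u \<notin># edges G" using holme_kim_loop[OF m t assms(5)] u(2) by force
    then have adj: "adjacent_targets G [u, w]" if "w \<in> neighbors G u" for w
      using that by (auto simp: adjacent_targets_def mem_neighbors_iff)
    have "vdegree G u > 0" using S(4)[of u] u(2) m by force
    then have "p * 1 \<le> measure_pmf.prob (next_choice m p t G u) (neighbors G u) * 1"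
      using prob_next_choice_neighbors[of G u p m t] S(1) assms by simp
    also have "\<dots> \<le> measure_pmf.prob (next_choice m p t G u \<bind> (\<lambda>y. return_pmf ([u] @ [y]))) ?A"
      by (rule prob_bind_pmf_ge) (auto simp: adj)
    finally show "p \<le> measure_pmf.prob ((if ys = [] then pref_choice m t G
        else next_choice m p t G (last ys)) \<bind> (\<lambda>y. return_pmf (ys @ [y]))) ?A"
      by (simp add: u)
  qed (use assms in auto)
  then have "p / 4 \<le> measure_pmf.prob (choices m p t G 2) ?A"
    using mult_right_mono[OF first, of p] assms by (simp add: numeral_2_eq_2)
  also have "\<dots> \<le> measure_pmf.prob (choices m p t G m) ?A"
  proof (rule lift_Suc_mono_le[OF _ assms(1)])
    show "measure_pmf.prob (choices m p t G i) ?A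
        \<le> measure_pmf.prob (choices m p t G (Suc i)) ?A" for i
      by (rule prob_choices_Suc_ge) (auto simp: adjacent_targets_def)
  qed
  finally show ?thesis .
qed

section \<open>Many vertices lie in a triangle\<close>

text \<open>The new vertex adds at least one to the number of vertices in triangles with probability at
  least \<open>p / 4\<close>, which halves the weight; on average the weight loses at least a proportion
  \<open>(p / 4) (1 / 2) = p / 8\<close>.\<close>

lemma exp_moment_step:
  assumes "m \<ge> 2" "t \<ge> 2" "0 \<le> p" "p \<le> 1" "G \<in> set_pmf (holme_kim m p t)"
  shows "(\<integral>\<^sup>+ys. ennreal ((1 / 2) ^ card (\<Union>(triangles (add_vertex G (Suc t) ys))))
            \<partial>choices m p t G m)
      \<le> ennreal (1 - p / 8) * ennreal ((1 / 2) ^ card (\<Union>(triangles G)))"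
proof -
  have m: "m > 0" and t: "t > 0" using assms by auto
  note S = holme_kim_support[OF m t assms(5)]
  let ?M = "choices m p t G m"
  let ?A = "{ys. adjacent_targets G ys}"
  define a :: real where "a = (1 / 2) ^ card (\<Union>(triangles G))"
  have a: "a \<ge> 0" by (simp add: a_def)
  have "(\<integral>\<^sup>+ys. ennreal ((1 / 2) ^ card (\<Union>(triangles (add_vertex G (Suc t) ys)))) \<partial>?M)
     \<le> (\<integral>\<^sup>+ys. ennreal (a * (1 - indicator ?A ys / 2)) \<partial>?M)"
  proof (rule nn_integral_mono_AE, unfold AE_measure_pmf_iff, intro ballI ennreal_leI)
    fix ys assume ys: "ys \<in> set_pmf ?M"
    have "set ys \<subseteq> verts G" "Suc t \<notin> verts G" "finite (verts G)"
      using choices_holme_kim_support(2)[OF m t assms(5) ys] S(1) by auto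
    then have "card (\<Union>(triangles G)) + of_bool (adjacent_targets G ys)
       \<le> card (\<Union>(triangles (add_vertex G (Suc t) ys)))"
      by (intro card_Union_triangles_add_vertex)
    then have "(1 / 2 :: real) ^ card (\<Union>(triangles (add_vertex G (Suc t) ys)))
       \<le> (1 / 2) ^ (card (\<Union>(triangles G)) + of_bool (adjacent_targets G ys))"
      by (intro power_decreasing) auto
    also have "\<dots> = a * (1 - indicator ?A ys / 2)"
      by (simp add: a_def power_add indicator_def)
    finally show "(1 / 2) ^ card (\<Union>(triangles (add_vertex G (Suc t) ys)))
       \<le> a * (1 - indicator ?A ys / 2)" .
  qed
  also have "\<dots> = ennreal (\<integral>ys. a * (1 - indicator ?A ys / 2) \<partial>?M)"
    using a by (intro nn_integral_eq_integral measure_pmf.integrable_const_bound[where B = a])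
      (auto simp: indicator_def)
  also have "(\<integral>ys. a * (1 - indicator ?A ys / 2) \<partial>?M)
      = a * (1 - measure_pmf.prob ?M ?A / 2)"
  proof -
    have "integrable ?M (indicat_real ?A)"
      by (intro measure_pmf.integrable_const_bound[where B = 1]) auto
    then show ?thesis by (simp add: measure_pmf.prob_space Bochner_Integration.integral_diff)
  qed
  also have "\<dots> \<le> a * (1 - p / 8)"
    using prob_adjacent_targets[OF assms] a by (intro mult_left_mono) auto
  finally show ?thesis
    using a assms by (simp add: a_def ennreal_mult[symmetric] mult.commute ennreal_leI)
qed

lemma exp_moment:
  assumes "m \<ge> 2" "0 \<le> p" "p \<le> 1"
  shows "(\<integral>\<^sup>+G. ennreal ((1 / 2) ^ card (\<Union>(triangles G))) \<partial>holme_kim m p (t + 2))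
      \<le> ennreal ((1 - p / 8) ^ t)"
proof (induction t)
  case 0
  have "(\<integral>\<^sup>+G. ennreal ((1 / 2) ^ card (\<Union>(triangles G))) \<partial>holme_kim m p 2)
      \<le> (\<integral>\<^sup>+G. 1 \<partial>holme_kim m p 2)"
    by (intro nn_integral_mono) (simp add: power_le_one)
  then show ?case by (simp del: holme_kim.simps add: measure_pmf.emeasure_space_1 flip: numeral_2_eq_2)
next
  case (Suc t)
  let ?f = "\<lambda>G. ennreal ((1 / 2) ^ card (\<Union>(triangles G)))"
  let ?t = "t + 2"
  have eq: "holme_kim m p (Suc t + 2) = holme_kim m p ?t \<bind>
      (\<lambda>G. choices m p ?t G m \<bind> (\<lambda>ys. return_pmf (add_vertex G (Suc ?t) ys)))"
    by simp
  have "(\<integral>\<^sup>+G. ?f G \<partial>holme_kim m p (Suc t + 2))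
      = (\<integral>\<^sup>+G. \<integral>\<^sup>+ys. ?f (add_vertex G (Suc ?t) ys) \<partial>choices m p ?t G m \<partial>holme_kim m p ?t)"
    unfolding eq by (simp del: holme_kim.simps add_2_eq_Suc')
  also have "\<dots> \<le> (\<integral>\<^sup>+G. ennreal (1 - p / 8) * ?f G \<partial>holme_kim m p ?t)"
  proof (rule nn_integral_mono_AE, unfold AE_measure_pmf_iff, rule ballI)
    fix G assume "G \<in> set_pmf (holme_kim m p ?t)"
    then show "(\<integral>\<^sup>+ys. ?f (add_vertex G (Suc ?t) ys) \<partial>choices m p ?t G m)
        \<le> ennreal (1 - p / 8) * ?f G"
      using assms by (intro exp_moment_step) auto
  qed
  also have "\<dots> = ennreal (1 - p / 8) * (\<integral>\<^sup>+G. ?f G \<partial>holme_kim m p ?t)"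
    by (rule nn_integral_cmult) simp
  also have "\<dots> \<le> ennreal (1 - p / 8) * ennreal ((1 - p / 8) ^ t)"
    using Suc.IH by (rule mult_left_mono) simp
  also have "\<dots> = ennreal ((1 - p / 8) ^ Suc t)"
    using assms by (simp add: ennreal_mult[symmetric])
  finally show ?case .
qed

text \<open>Markov's inequality for \<open>(1 / 2) ^ N\<close>, which exceeds \<open>2 powr (- x)\<close> when \<open>N < x\<close>.\<close>

lemma prob_few_triangles:
  assumes "m \<ge> 2" "0 \<le> p" "p \<le> 1"
  shows "measure_pmf.prob (holme_kim m p (t + 2)) {G. real (card (\<Union>(triangles G))) < x}
      \<le> 2 powr x * (1 - p / 8) ^ t"
proof -
  let ?M = "holme_kim m p (t + 2)" and ?A = "{G. real (card (\<Union>(triangles G))) < x}"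
  have "ennreal (measure_pmf.prob ?M ?A) = (\<integral>\<^sup>+G. indicator ?A G \<partial>?M)"
    by (simp add: measure_pmf.emeasure_eq_measure[symmetric] del: ennreal_indicator)
  also have "\<dots> \<le> (\<integral>\<^sup>+G. ennreal (2 powr x) * ennreal ((1 / 2) ^ card (\<Union>(triangles G))) \<partial>?M)"
  proof (rule nn_integral_mono)
    fix G :: "nat multigraph"
    let ?N = "card (\<Union>(triangles G))"
    have "1 \<le> 2 powr x * (1 / 2) ^ ?N" if "real ?N < x"
    proof -
      have "2 powr x * (1 / 2) ^ ?N = 2 powr (x - real ?N)"
        by (simp add: powr_diff powr_realpow power_divide)
      then show ?thesis using that by (simp add: ge_one_powr_ge_zero)
    qed
    then show "indicator ?A G \<le> ennreal (2 powr x) * ennreal ((1 / 2) ^ ?N)"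
      by (auto simp: indicator_def ennreal_mult[symmetric])
  qed
  also have "\<dots> = ennreal (2 powr x) * (\<integral>\<^sup>+G. ennreal ((1 / 2) ^ card (\<Union>(triangles G))) \<partial>?M)"
    by (rule nn_integral_cmult) simp
  also have "\<dots> \<le> ennreal (2 powr x) * ennreal ((1 - p / 8) ^ t)"
    using exp_moment[OF assms] by (rule mult_left_mono) simp
  also have "\<dots> = ennreal (2 powr x * (1 - p / 8) ^ t)"
    using assms by (simp add: ennreal_mult[symmetric])
  finally show ?thesis using assms by simp
qed

theorem theorem1:
  fixes m :: nat and p :: real
  assumes "m \<ge> 2" and "0 < p" and "p < 1"
  shows "\<exists>c>0. (\<lambda>t. measure_pmf.prob (holme_kim m p t) {G. local_clustering G \<ge> c})
           \<longlonglongrightarrow> 1"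
proof -
  define r where "r = 1 - p / 8"
  have r: "0 < r" "r < 1" using assms by (auto simp: r_def)
  \<comment> \<open>This \<open>\<delta>\<close> makes \<open>2 powr (\<delta> t)\<close> grow like \<open>(1 / sqrt r) ^ t\<close>, so the tail bound, in
    which it is multiplied by \<open>r ^ t\<close>, still decays like \<open>sqrt r ^ t\<close>.\<close>
  define \<delta> where "\<delta> = - log 2 r / 2"
  have \<delta>: "\<delta> > 0" using r by (simp add: \<delta>_def)
  have two_\<delta>: "2 powr \<delta> = 1 / sqrt r"
  proof -
    have "2 powr \<delta> = (2 powr log 2 r) powr (- 1 / 2)"
      unfolding powr_powr by (simp add: \<delta>_def)
    also have "\<dots> = 1 / sqrt r"
      using r by (simp add: powr_minus_divide powr_half_sqrt)
    finally show ?thesis .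
  qed
  obtain D :: nat where D: "D \<ge> 2" "real D * \<delta> \<ge> 2 * real (2 * m)"
  proof -
    obtain d :: nat where d: "real d \<ge> 2 * real (2 * m) / \<delta>" using real_arch_simple by blast
    have "2 * real (2 * m) \<le> real d * \<delta>" using d \<delta> by (simp add: pos_divide_le_eq)
    also have "\<dots> \<le> real (max 2 d) * \<delta>" using \<delta> by (intro mult_right_mono) auto
    finally show ?thesis using that[of "max 2 d"] by simp
  qed
  define c where "c = \<delta> / (2 * real (D choose 2))"
  have "c > 0" using \<delta> D(1) by (simp add: c_def)
  have lower: "1 - (1 / sqrt r) ^ 2 * sqrt r ^ t
      \<le> measure_pmf.prob (holme_kim m p (t + 2)) {G. local_clustering G \<ge> c}" for t
  proof -
    let ?M = "holme_kim m p (t + 2)"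
    let ?few = "{G. real (card (\<Union>(triangles G))) < \<delta> * real (t + 2)}"
    have imp: "local_clustering G \<ge> c" if G: "G \<in> set_pmf ?M" "G \<notin> ?few" for G
    proof -
      have m: "m > 0" using assms by simp
      note S = holme_kim_support[OF m _ G(1)]
      have V: "verts G = {1..t + 2}" using S(1) by simp
      have "(\<Sum>v\<in>verts G. vdegree G v) = 2 * m * card (verts G)"
        using handshake[of G] S(1-3) by auto
      moreover have "vdegree G v \<ge> 2" if "v \<in> verts G" for v
        using S(4)[of v] that V assms(1) by force
      ultimately show ?thesis
        unfolding c_def using G(2) V \<delta> D
        by (intro local_clustering_ge[where k = "2 * m"]) auto
    qed
    have "1 - measure_pmf.prob ?M ?few = measure_pmf.prob ?M (- ?few)"
      using measure_pmf.prob_compl[of ?few ?M] by (simp add: Compl_eq_Diff_UNIV)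
    also have "\<dots> \<le> measure_pmf.prob ?M {G. local_clustering G \<ge> c}"
      using imp by (intro measure_pmf.finite_measure_mono_AE) (auto simp: AE_measure_pmf_iff)
    finally have "1 - measure_pmf.prob ?M ?few
        \<le> measure_pmf.prob ?M {G. local_clustering G \<ge> c}" .
    moreover have "measure_pmf.prob ?M ?few \<le> 2 powr (\<delta> * real (t + 2)) * r ^ t"
      unfolding r_def using assms by (intro prob_few_triangles) auto
    moreover have "2 powr (\<delta> * real (t + 2)) * r ^ t = (1 / sqrt r) ^ 2 * sqrt r ^ t"
    proof -
      have "2 powr (\<delta> * real (t + 2)) = (1 / sqrt r) ^ (t + 2)"
        using r by (simp only: powr_powr[symmetric] two_\<delta>) (subst powr_realpow, simp_all)
      moreover have "r ^ t = sqrt r ^ t * sqrt r ^ t"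
        using r by (simp add: power_mult_distrib[symmetric])
      ultimately show ?thesis using r by (simp only: power_add) (simp add: power_divide)
    qed
    ultimately show ?thesis by linarith
  qed
  have "(\<lambda>t. 1 - (1 / sqrt r) ^ 2 * sqrt r ^ t) \<longlonglongrightarrow> 1 - (1 / sqrt r) ^ 2 * 0"
    using r by (intro tendsto_intros LIMSEQ_power_zero) auto
  then have lim: "(\<lambda>t. 1 - (1 / sqrt r) ^ 2 * sqrt r ^ t) \<longlonglongrightarrow> 1" by simp
  have "(\<lambda>t. measure_pmf.prob (holme_kim m p (t + 2)) {G. local_clustering G \<ge> c}) \<longlonglongrightarrow> 1"
    using lower by (intro tendsto_sandwich[OF _ _ lim tendsto_const]) auto
  then have "(\<lambda>t. measure_pmf.prob (holme_kim m p t) {G. local_clustering G \<ge> c}) \<longlonglongrightarrow> 1"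
    by (rule LIMSEQ_offset)
  with \<open>c > 0\<close> show ?thesis by blast
qed

end
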